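(* Let $T$ be a tree of diameter $2$. Then $\operatorname{con}(T\overline{T})=2n(T)-1$.
   Context: For a graph $G$ with complement $\overline{G}$, the complementary prism $G\overline{G}$ is the graph obtained from the disjoint union of $G$ and $\overline{G}$ by adding the perfect matching joining each vertex $v$ of $G$ to its copy $\overline{v}$ in $\overline{G}$. For a graph $H$, a set $S\subseteq V(H)$ is (geodesically) convex if every vertex on every shortest path between two vertices of $S$ belongs to $S$. The convexity number $\operatorname{con}(H)$ is the maximum cardinality of a proper (i.e. $\neq V(H)$) convex set of $H$. $n(T)=|V(T)|$. *)

theory Defs
  imports "Graph_Theory.Graph_Theory"
begin

text \<open>
  A finite simple graph is a \<^locale>\<open>pair_graph\<close>: a finite, loop-free, symmetric digraph whose
  arcs are pairs of vertices, so that an edge \<open>uv\<close> is the pair of arcs \<open>(u, v)\<close>, \<open>(v, u)\<close>.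
\<close>

text \<open>
  The library predicate \<open>forest\<close> (hence \<open>tree\<close>) counts the closed walk \<open>u, v, u\<close> along a single
  edge as a cycle, so on symmetric digraphs it excludes every graph with an edge.  The cycles of
  a simple graph are the library cycles of length at least 3.
\<close>

definition undirected_tree :: "'a pair_pre_digraph \<Rightarrow> bool" where
  "undirected_tree G \<longleftrightarrow>
     connected (with_proj G) \<and>
     \<not> (\<exists>p. pre_digraph.cycle (with_proj G) p \<and> 3 \<le> length p)"

definition graph_dist :: "'a pair_pre_digraph \<Rightarrow> 'a \<Rightarrow> 'a \<Rightarrow> ereal" where
  "graph_dist G u v = wf_digraph.\<mu> (with_proj G) (\<lambda>_. 1) u v"

definition graph_diameter :: "'a pair_pre_digraph \<Rightarrow> ereal" where
  "graph_diameter G = (SUP (u, v) \<in> pverts G \<times> pverts G. graph_dist G u v)"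

definition shortest_path :: "'a pair_pre_digraph \<Rightarrow> 'a \<Rightarrow> ('a \<times> 'a) awalk \<Rightarrow> 'a \<Rightarrow> bool" where
  "shortest_path G u p v \<longleftrightarrow>
     pre_digraph.apath (with_proj G) u p v \<and> ereal (real (length p)) = graph_dist G u v"

definition geodesically_convex :: "'a pair_pre_digraph \<Rightarrow> 'a set \<Rightarrow> bool" where
  "geodesically_convex G S \<longleftrightarrow>
     S \<subseteq> pverts G \<and>
     (\<forall>u \<in> S. \<forall>v \<in> S. \<forall>p. shortest_path G u p v \<longrightarrow> set (pawalk_verts u p) \<subseteq> S)"

definition convexity_number :: "'a pair_pre_digraph \<Rightarrow> nat" where
  "convexity_number G = Max {card S |S. geodesically_convex G S \<and> S \<noteq> pverts G}"

definition graph_complement :: "'a pair_pre_digraph \<Rightarrow> 'a pair_pre_digraph" where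
  "graph_complement G =
     \<lparr> pverts = pverts G,
       parcs = {(u, v). u \<in> pverts G \<and> v \<in> pverts G \<and> u \<noteq> v \<and> (u, v) \<notin> parcs G} \<rparr>"

text \<open>\<open>Inl v\<close> is the vertex \<open>v\<close> of \<open>G\<close>, and \<open>Inr v\<close> is its copy in the complement of \<open>G\<close>.\<close>

definition complementary_prism :: "'a pair_pre_digraph \<Rightarrow> ('a + 'a) pair_pre_digraph" where
  "complementary_prism G =
     \<lparr> pverts = pverts G <+> pverts (graph_complement G),
       parcs = {(Inl u, Inl v) |u v. (u, v) \<in> parcs G}
             \<union> {(Inr u, Inr v) |u v. (u, v) \<in> parcs (graph_complement G)}
             \<union> {(Inl v, Inr v) |v. v \<in> pverts G}
             \<union> {(Inr v, Inl v) |v. v \<in> pverts G} \<rparr>"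

lemma pair_graphI:
  assumes "finite (pverts G)"
    and "parcs G \<subseteq> pverts G \<times> pverts G"
    and "\<And>v. (v, v) \<notin> parcs G"
    and "sym (parcs G)"
  shows "pair_graph G"
proof
  show "finite (parcs G)"
    by (rule finite_subset[OF assms(2) finite_cartesian_product[OF assms(1) assms(1)]])
  show "symmetric (with_proj G)"
    using assms(4) by (simp add: symmetric_def)
  show "finite (pverts G)" by fact
  show "fst e \<in> pverts G" if "e \<in> parcs G" for e
    using assms(2) that by (cases e) auto
  show "snd e \<in> pverts G" if "e \<in> parcs G" for e
    using assms(2) that by (cases e) auto
  show "fst e \<noteq> snd e" if "e \<in> parcs G" for e
    using assms(3) that by (cases e) auto
qed

lemma pair_graphD:
  assumes "pair_graph G"
  shows "finite (pverts G)"
    and "parcs G \<subseteq> pverts G \<times> pverts G"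
    and "(v, v) \<notin> parcs G"
    and "sym (parcs G)"
proof -
  interpret pair_graph G by fact
  show "finite (pverts G)" by (rule pair_finite_verts)
  show "parcs G \<subseteq> pverts G \<times> pverts G"
    by (auto dest: in_arcsD1 in_arcsD2)
  show "(v, v) \<notin> parcs G" using pair_no_loops[of "(v, v)"] by auto
  show "sym (parcs G)" using pair_sym_arcs by (simp add: symmetric_def)
qed

lemma pair_graph_complement:
  assumes "pair_graph G"
  shows "pair_graph (graph_complement G)"
  using pair_graphD(1,4)[OF assms]
  by (intro pair_graphI) (auto simp: graph_complement_def sym_def)

lemma pair_graph_complementary_prism:
  assumes "pair_graph G"
  shows "pair_graph (complementary_prism G)"
proof -
  have compl: "pverts (graph_complement G) = pverts G"
    by (simp add: graph_complement_def)
  note G = pair_graphD[OF assms]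
    and C = pair_graphD[OF pair_graph_complement[OF assms], unfolded compl]
  show ?thesis
  proof (rule pair_graphI)
    show "finite (pverts (complementary_prism G))"
      using G(1) by (simp add: complementary_prism_def compl)
    show "parcs (complementary_prism G)
        \<subseteq> pverts (complementary_prism G) \<times> pverts (complementary_prism G)"
      using G(2) C(2) by (auto simp: complementary_prism_def compl)
    show "(v, v) \<notin> parcs (complementary_prism G)" for v
      using G(3) C(3) by (auto simp: complementary_prism_def)
    show "sym (parcs (complementary_prism G))"
      using G(4) C(4) unfolding sym_def by (simp add: complementary_prism_def) blast
  qed
qed

text \<open>The set whose maximum is the convexity number is finite and nonempty.\<close>

lemma convexity_number_set:
  assumes "pair_graph G" and "pverts G \<noteq> {}"
  shows "finite {card S |S. geodesically_convex G S \<and> S \<noteq> pverts G}"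
    and "{card S |S. geodesically_convex G S \<and> S \<noteq> pverts G} \<noteq> {}"
proof -
  have "{card S |S. geodesically_convex G S \<and> S \<noteq> pverts G} \<subseteq> card ` Pow (pverts G)"
    by (auto simp: geodesically_convex_def)
  then show "finite {card S |S. geodesically_convex G S \<and> S \<noteq> pverts G}"
    by (rule finite_subset) (simp add: pair_graphD(1)[OF assms(1)])
  have "geodesically_convex G {}"
    by (simp add: geodesically_convex_def)
  then show "{card S |S. geodesically_convex G S \<and> S \<noteq> pverts G} \<noteq> {}"
    using assms(2) by blast
qed

end

theory Submission
  imports Defs
begin

text \<open>
  A tree of diameter 2 is a star.  The copy in the complement of its centre \<open>c\<close> is isolated in the
  complement, hence a leaf of the complementary prism.  No shortest path passes through a leaf,
  so all vertices but this one form a convex set.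
\<close>

text \<open>\<open>graph_dist\<close> is an infimum of walk costs in \<open>ereal\<close>. A strict
  bound on an infimum is witnessed by a single walk, which spares an argument that the infimum is
  attained.\<close>

lemma graph_dist_less_imp_awalk:
  assumes "pair_wf_digraph G" and "graph_dist G u v < ereal (real k)"
  obtains p where "pre_digraph.awalk (with_proj G) u p v" and "length p < k"
proof -
  interpret pair_wf_digraph G by fact
  have cost: "awalk_cost (\<lambda>_. 1) p = real (length p)" for p
    by (induction p) auto
  from assms(2) obtain p where "awalk u p v" "length p < k"
    by (auto simp: graph_dist_def \<mu>_def INF_less_iff cost)
  then show thesis by (rule that)
qed

lemma graph_dist_le_length:
  assumes "pair_wf_digraph G" and "pre_digraph.awalk (with_proj G) u p v"
  shows "graph_dist G u v \<le> ereal (real (length p))"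
proof -
  interpret pair_wf_digraph G by fact
  have "awalk_cost (\<lambda>_. 1) p = real (length p)"
    by (induction p) auto
  then show ?thesis
    using min_cost_le_walk_cost[OF assms(2), of "\<lambda>_. 1"] by (simp add: graph_dist_def)
qed

lemma graph_dist_le_2_cases:
  assumes "pair_wf_digraph G" and "graph_dist G u v \<le> 2"
  obtains "u = v" | "(u, v) \<in> parcs G" | x where "(u, x) \<in> parcs G" "(x, v) \<in> parcs G"
proof -
  interpret pair_wf_digraph G by fact
  \<comment> \<open>The bound is made strict so that a walk can be extracted. Lengths are natural
    numbers, so a walk shorter than 3 still has at most two arcs.\<close>
  have "graph_dist G u v < ereal (real 3)"
    using assms(2) by (rule order_le_less_trans) simp
  then obtain p where p: "awalk u p v" "length p < 3"
    using graph_dist_less_imp_awalk[OF assms(1)] by blast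
  then consider "p = []" | e where "p = [e]" | e f where "p = [e, f]"
    by (cases p; cases "tl p") auto
  then show thesis
    by cases (use p that in \<open>auto simp: awalk_def\<close>)
qed

context pair_graph
begin

lemma arc_sym: "(u, v) \<in> parcs G \<Longrightarrow> (v, u) \<in> parcs G"
  by (rule arcs_symmetric)

lemma arc_neq: "(u, v) \<in> parcs G \<Longrightarrow> u \<noteq> v"
  using pair_no_loops by fastforce

text \<open>If \<open>w\<close> were not adjacent to \<open>c\<close>, it would be reached through a
  neighbour \<open>x\<close> of \<open>c\<close>. A walk of at most two arcs from \<open>w\<close>
  to another neighbour \<open>y\<close> of \<open>c\<close> then produces a cycle of length 3, 4 or
  5 through \<open>c\<close>.\<close>

lemma acyclic_radius_2_universal:
  assumes acyc: "\<not> (\<exists>p. cycle p \<and> 3 \<le> length p)"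
    and dist: "\<And>x y. x \<in> pverts G \<Longrightarrow> y \<in> pverts G \<Longrightarrow> graph_dist G x y \<le> 2"
    and cu: "(c, u) \<in> parcs G" and cv: "(c, v) \<in> parcs G" and "u \<noteq> v"
    and w: "w \<in> pverts G" and "w \<noteq> c"
  shows "(c, w) \<in> parcs G"
proof (rule ccontr)
  assume cw: "(c, w) \<notin> parcs G"
  have no_cycle: "\<not> cycle p" if "3 \<le> length p" for p
    using acyc that by blast
  have wf: "pair_wf_digraph G" by unfold_locales
  have c: "c \<in> pverts G" using cu by (rule in_arcsD1)
  obtain x where cx: "(c, x) \<in> parcs G" and xw: "(x, w) \<in> parcs G"
    using graph_dist_le_2_cases[OF wf dist[OF c w]] \<open>w \<noteq> c\<close> cw by metis
  \<comment> \<open>At least one of \<open>u\<close> and \<open>v\<close> differs from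
    \<open>x\<close>; this is why \<open>c\<close> is given two neighbours.\<close>
  obtain y where cy: "(c, y) \<in> parcs G" and "y \<noteq> x"
    using cu cv \<open>u \<noteq> v\<close> by blast
  have y: "y \<in> pverts G" using cy by (rule in_arcsD2)
  from wf dist[OF w y] show False
  proof (cases rule: graph_dist_le_2_cases)
    assume "w = y"
    with cy cw show False by simp
  next
    assume wy: "(w, y) \<in> parcs G"
    have "cycle [(c, x), (x, w), (w, y), (y, c)]"
      unfolding cycle_def
      using c cx xw wy arc_sym[OF cy] \<open>y \<noteq> x\<close> \<open>w \<noteq> c\<close> arc_neq[OF cx] arc_neq[OF xw]
        arc_neq[OF cy] arc_neq[OF wy]
      by (intro exI[of _ c]) (auto simp: awalk_def)
    then show False using no_cycle by force
  next
    fix z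
    assume wz: "(w, z) \<in> parcs G" and zy: "(z, y) \<in> parcs G"
    have "z \<noteq> c" using arc_sym[OF wz] cw by blast
    have "w \<noteq> y" using cy cw by auto
    show False
    \<comment> \<open>If the walk goes back through \<open>x\<close>, then \<open>x\<close> and
      \<open>y\<close> are adjacent and form a triangle with \<open>c\<close>. Otherwise
      \<open>c\<close>, \<open>x\<close>, \<open>w\<close>, \<open>z\<close>, \<open>y\<close> are
      five distinct vertices on a cycle.\<close>
    proof (cases "z = x")
      case True
      have "cycle [(c, x), (x, y), (y, c)]"
        unfolding cycle_def
        using c cx zy arc_sym[OF cy] True \<open>y \<noteq> x\<close> arc_neq[OF cx] arc_neq[OF cy]
        by (intro exI[of _ c]) (auto simp: awalk_def)
      then show False using no_cycle by force
    next
      case False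
      have "cycle [(c, x), (x, w), (w, z), (z, y), (y, c)]"
        unfolding cycle_def
        using c cx xw wz zy arc_sym[OF cy] False \<open>y \<noteq> x\<close> \<open>z \<noteq> c\<close> \<open>w \<noteq> y\<close> \<open>w \<noteq> c\<close>
          arc_neq[OF cx] arc_neq[OF xw] arc_neq[OF wz] arc_neq[OF zy] arc_neq[OF cy]
        by (intro exI[of _ c]) (auto simp: awalk_def)
      then show False using no_cycle by force
    qed
  qed
qed

end

text \<open>The centre is the midpoint of two vertices at distance 2. These are two distinct
  neighbours of it, so acyclicity makes it adjacent to all other vertices.\<close>

lemma undirected_tree_diameter_2_universal:
  assumes "pair_graph T" and "undirected_tree T" and "graph_diameter T = 2"
  obtains c where "c \<in> pverts T" and "\<And>w. w \<in> pverts T \<Longrightarrow> w \<noteq> c \<Longrightarrow> (c, w) \<in> parcs T"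
proof -
  interpret pair_graph T by fact
  have wf: "pair_wf_digraph T" by unfold_locales
  have dist: "graph_dist T x y \<le> 2" if "x \<in> pverts T" "y \<in> pverts T" for x y
    using that assms(3)[symmetric] unfolding graph_diameter_def
    by (auto intro!: SUP_upper2[of "(x, y)"])
  \<comment> \<open>A supremum above 1 has a member above 1. Such a pair of vertices is neither
    equal nor adjacent, so it has a common neighbour.\<close>
  have "1 < graph_diameter T"
    using assms(3) by simp
  then obtain u v where uv: "u \<in> pverts T" "v \<in> pverts T" and far: "1 < graph_dist T u v"
    unfolding graph_diameter_def less_SUP_iff by auto
  have "u \<noteq> v"
  proof
    assume "u = v"
    then have "awalk u [] v" using uv by (simp add: awalk_def)
    from graph_dist_le_length[OF wf this] far show False
      by (auto dest: order_less_le_trans)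
  qed
  moreover have "(u, v) \<notin> parcs T"
  proof
    assume "(u, v) \<in> parcs T"
    then have "awalk u [(u, v)] v" using uv by (simp add: awalk_def)
    from graph_dist_le_length[OF wf this] far show False
      by (auto dest: order_less_le_trans)
  qed
  ultimately obtain c where uc: "(u, c) \<in> parcs T" and cv: "(c, v) \<in> parcs T"
    using graph_dist_le_2_cases[OF wf dist[OF uv]] by metis
  show thesis
  proof
    show "c \<in> pverts T" using cv by (rule in_arcsD1)
    show "(c, w) \<in> parcs T" if "w \<in> pverts T" "w \<noteq> c" for w
      using acyclic_radius_2_universal[OF _ dist arc_sym[OF uc] cv \<open>u \<noteq> v\<close> that] assms(2)
      by (auto simp: undirected_tree_def)
  qed
qed

text \<open>A walk can enter \<open>b\<close> only from \<open>a\<close> and, since it does not end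
  at \<open>b\<close>, must go on to \<open>a\<close>. It then visits \<open>a\<close> twice,
  against distinctness.\<close>

lemma leaf_notin_path:
  assumes "\<And>x. (x, b) \<in> A \<Longrightarrow> x = a" and "\<And>x. (b, x) \<in> A \<Longrightarrow> x = a"
    and "pcas u p v" and "set p \<subseteq> A" and "distinct (pawalk_verts u p)" and "u \<noteq> b" and "v \<noteq> b"
  shows "b \<notin> set (pawalk_verts u p)"
  using assms(3-7)
proof (induction p arbitrary: u)
  case (Cons e es)
  have e: "e = (u, snd e)" using Cons.prems(1) by (simp add: prod_eq_iff)
  show ?case
  proof (cases "snd e = b")
    case True
    then have "u = a" using assms(1) e Cons.prems(2) by auto
    \<comment> \<open>The arc \<open>e\<close> ends at \<open>b\<close> and the walk ends at
      \<open>v\<close>, which is not \<open>b\<close>, so another arc follows.\<close>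
    obtain f fs where es: "es = f # fs"
      using Cons.prems(1,5) True by (cases es) auto
    then have "snd f = a"
      using assms(2) Cons.prems(1,2) True by (cases f) auto
    then have "a \<in> set (pawalk_verts (snd f) fs)"
      by (cases fs) (use es Cons.prems(1) in auto)
    then show ?thesis
      using Cons.prems(1,3) \<open>u = a\<close> es by auto
  next
    case False
    \<comment> \<open>The tail starts at \<open>snd e\<close>, which is not \<open>b\<close>, so the
      induction hypothesis applies to it.\<close>
    then show ?thesis using Cons by auto
  qed
qed simp

text \<open>Of a shortest path only the distinctness of its vertices matters: no path of any length
  passes through a leaf on its way between two other vertices.\<close>

lemma geodesically_convex_minus_leaf:
  assumes "\<And>x. (x, b) \<in> parcs G \<Longrightarrow> x = a" and "\<And>x. (b, x) \<in> parcs G \<Longrightarrow> x = a"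
    and "pair_wf_digraph G"
  shows "geodesically_convex G (pverts G - {b})"
  unfolding geodesically_convex_def
proof (intro conjI ballI allI impI)
  interpret pair_wf_digraph G by fact
  fix u v p
  assume uv: "u \<in> pverts G - {b}" "v \<in> pverts G - {b}" and "shortest_path G u p v"
  then have p: "awalk u p v" "distinct (pawalk_verts u p)"
    by (auto simp: shortest_path_def apath_def)
  have "b \<notin> set (pawalk_verts u p)"
    using leaf_notin_path[of b "parcs G", OF assms(1,2)] p uv by (auto simp: awalk_def)
  moreover have "set (pawalk_verts u p) \<subseteq> pverts G"
    using p(1) awalk_verts_in_verts by (auto simp: awalk_def)
  ultimately show "set (pawalk_verts u p) \<subseteq> pverts G - {b}" by blast
qed blast

text \<open>A proper subset of the finite vertex set misses at least one vertex, and deleting just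
  the leaf attains this bound.\<close>

lemma convexity_number_leaf:
  assumes "pair_graph G" and "b \<in> pverts G"
    and "\<And>x. (x, b) \<in> parcs G \<Longrightarrow> x = a" and "\<And>x. (b, x) \<in> parcs G \<Longrightarrow> x = a"
  shows "convexity_number G = card (pverts G) - 1"
  unfolding convexity_number_def
proof (rule Max_eqI)
  interpret pair_graph G by fact
  show "finite {card S |S. geodesically_convex G S \<and> S \<noteq> pverts G}"
    using assms(1,2) by (intro convexity_number_set) auto
  show "n \<le> card (pverts G) - 1"
    if "n \<in> {card S |S. geodesically_convex G S \<and> S \<noteq> pverts G}" for n
  proof -
    from that obtain S where "n = card S" and S: "S \<subset> pverts G"
      by (auto simp: geodesically_convex_def)
    moreover from pair_finite_verts S have "card S < card (pverts G)"
      by (rule psubset_card_mono)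
    ultimately show ?thesis by linarith
  qed
  have "geodesically_convex G (pverts G - {b})"
    using assms(3,4) by (rule geodesically_convex_minus_leaf) unfold_locales
  then show "card (pverts G) - 1 \<in> {card S |S. geodesically_convex G S \<and> S \<noteq> pverts G}"
    using assms(2) by (intro CollectI exI[of _ "pverts G - {b}"]) auto
qed

theorem theorem3p12:
  fixes T :: "'a pair_pre_digraph"
  assumes "pair_graph T"
    and "undirected_tree T"
    and "graph_diameter T = 2"
  shows "convexity_number (complementary_prism T) = 2 * card (pverts T) - 1"
proof -
  interpret pair_graph T by fact
  obtain c where c: "c \<in> pverts T"
    and univ: "\<And>w. w \<in> pverts T \<Longrightarrow> w \<noteq> c \<Longrightarrow> (c, w) \<in> parcs T"
    using undirected_tree_diameter_2_universal[OF assms] by blast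
  have "convexity_number (complementary_prism T) = card (pverts (complementary_prism T)) - 1"
  proof (rule convexity_number_leaf[OF pair_graph_complementary_prism[OF assms(1)]])
    show "Inr c \<in> pverts (complementary_prism T)"
      using c by (auto simp: complementary_prism_def graph_complement_def)
    \<comment> \<open>An arc between \<open>Inr c\<close> and another copy would require a vertex
      other than \<open>c\<close> that is not adjacent to \<open>c\<close> in \<open>T\<close>, so
      only the matching arc is left.\<close>
    show "x = Inl c" if "(x, Inr c) \<in> parcs (complementary_prism T)" for x
      using that univ[THEN arc_sym] by (auto simp: complementary_prism_def graph_complement_def)
    show "x = Inl c" if "(Inr c, x) \<in> parcs (complementary_prism T)" for x
      using that univ by (auto simp: complementary_prism_def graph_complement_def)
  qed
  also have "card (pverts (complementary_prism T)) = 2 * card (pverts T)"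
    by (simp add: complementary_prism_def graph_complement_def card_Plus pair_finite_verts)
  finally show ?thesis .
qed

end
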